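(* Let $\delta\in\mathbb C^\times$. Every $\delta$-mock-Novikov algebra $(\mathcal A,\circ)$ over $\mathbb C$ satisfying $\mathcal A^2\subseteq\operatorname{Ann}(\mathcal A)$ is differentially special.
   Context: The ground field is $\mathbb C$ and $\delta\in\mathbb C^\times$. An algebra is a vector space with a bilinear product, not necessarily associative. A $\delta$-mock-Novikov algebra is an algebra $(\mathcal A,\circ)$ such that for all $a,b,c\in\mathcal A$ $$\delta(a\circ b)\circ c+\delta(b\circ a)\circ c+a\circ(b\circ c)+b\circ(a\circ c)=0,\qquad (a\circ b)\circ c+(a\circ c)\circ b=0.$$ $\mathcal A^2$ is the linear span of all products $a\circ b$, and $\operatorname{Ann}(\mathcal A)=\{x\in\mathcal A\mid x\circ \mathcal A=\mathcal A\circ x=0\}$. A $\delta$-differential anti-commutative anti-associative algebra is a triple $(\mathcal B,\ast,\varphi)$ where $(\mathcal B,\ast)$ is an algebra with $x\ast y=-y\ast x$ and $(x\ast y)\ast z=-x\ast(y\ast z)$ for all $x,y,z$, and $\varphi:\mathcal B\to\mathcal B$ is a linear map which is a $\delta$-derivation: $\varphi(x\ast y)=\delta(\varphi(x)\ast y+x\ast\varphi(y))$ for all $x,y\in\mathcal B$. A $\delta$-mock-Novikov algebra $(\mathcal A,\circ)$ is differentially special if there exist a $\delta$-differential anti-commutative anti-associative algebra $(\mathcal B,\ast,\varphi)$ and an injective algebra homomorphism $\mathcal A\to\mathcal B_\varphi$, where $\mathcal B_\varphi$ is the vector space $\mathcal B$ with product $x\circ_\varphi y=x\ast\varphi(y)$.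 *)

theory Defs
  imports Complex_Main "HOL-Library.Function_Algebras"
begin

locale nonassoc_algebra = vector_space scale
  for scale :: "complex \<Rightarrow> 'a::ab_group_add \<Rightarrow> 'a" +
  fixes mul :: "'a \<Rightarrow> 'a \<Rightarrow> 'a"
  assumes linear_mul_left: "Vector_Spaces.linear scale scale (\<lambda>x. mul x y)"
    and linear_mul_right: "Vector_Spaces.linear scale scale (mul x)"

locale mock_novikov_algebra = nonassoc_algebra scale mul
  for \<delta> :: complex
    and scale :: "complex \<Rightarrow> 'a::ab_group_add \<Rightarrow> 'a"
    and mul :: "'a \<Rightarrow> 'a \<Rightarrow> 'a" +
  assumes mock_left_symmetry:
      "scale \<delta> (mul (mul a b) c) + scale \<delta> (mul (mul b a) c) + mul a (mul b c) + mul b (mul a c) = 0"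
    and mock_right_commutativity: "mul (mul a b) c + mul (mul a c) b = 0"

definition algebra_square ::
    "(complex \<Rightarrow> 'a::ab_group_add \<Rightarrow> 'a) \<Rightarrow> ('a \<Rightarrow> 'a \<Rightarrow> 'a) \<Rightarrow> 'a set" where
  "algebra_square scale mul = module.span scale {mul a b | a b. True}"

definition algebra_annihilator :: "('a::ab_group_add \<Rightarrow> 'a \<Rightarrow> 'a) \<Rightarrow> 'a set" where
  "algebra_annihilator mul = {x. \<forall>a. mul x a = 0 \<and> mul a x = 0}"

definition algebra_hom ::
    "(complex \<Rightarrow> 'a::ab_group_add \<Rightarrow> 'a) \<Rightarrow> ('a \<Rightarrow> 'a \<Rightarrow> 'a) \<Rightarrow>
     (complex \<Rightarrow> 'b::ab_group_add \<Rightarrow> 'b) \<Rightarrow> ('b \<Rightarrow> 'b \<Rightarrow> 'b) \<Rightarrow> ('a \<Rightarrow> 'b) \<Rightarrow> bool" where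
  "algebra_hom scale mul scale' mul' f \<longleftrightarrow>
     Vector_Spaces.linear scale scale' f \<and> (\<forall>x y. f (mul x y) = mul' (f x) (f y))"

locale differential_anticomm_antiassoc_algebra = nonassoc_algebra scale mul
  for \<delta> :: complex
    and scale :: "complex \<Rightarrow> 'b::ab_group_add \<Rightarrow> 'b"
    and mul :: "'b \<Rightarrow> 'b \<Rightarrow> 'b"
    and \<phi> :: "'b \<Rightarrow> 'b" +
  assumes anticommutative: "mul x y = - mul y x"
    and antiassociative: "mul (mul x y) z = - mul x (mul y z)"
    and linear_derivation: "Vector_Spaces.linear scale scale \<phi>"
    and derivation: "\<phi> (mul x y) = scale \<delta> (mul (\<phi> x) y + mul x (\<phi> y))"

definition derived_mul :: "('b \<Rightarrow> 'b \<Rightarrow> 'b) \<Rightarrow> ('b \<Rightarrow> 'b) \<Rightarrow> 'b \<Rightarrow> 'b \<Rightarrow> 'b" where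
  "derived_mul bmul \<phi> = (\<lambda>x y. bmul x (\<phi> y))"

text \<open>Differential speciality with the underlying vector space of the target algebra prescribed.\<close>

definition differentially_special_in ::
    "complex \<Rightarrow> (complex \<Rightarrow> 'b::ab_group_add \<Rightarrow> 'b) \<Rightarrow>
     (complex \<Rightarrow> 'a::ab_group_add \<Rightarrow> 'a) \<Rightarrow> ('a \<Rightarrow> 'a \<Rightarrow> 'a) \<Rightarrow> bool" where
  "differentially_special_in \<delta> bscale scale mul \<longleftrightarrow>
     (\<exists>bmul \<phi> f. differential_anticomm_antiassoc_algebra \<delta> bscale bmul \<phi> \<and>
        algebra_hom scale mul bscale (derived_mul bmul \<phi>) f \<and> inj f)"

definition pointwise_scale :: "(complex \<Rightarrow> 'a \<Rightarrow> 'a) \<Rightarrow> complex \<Rightarrow> (nat \<Rightarrow> 'a) \<Rightarrow> nat \<Rightarrow> 'a" where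
  "pointwise_scale scale c v = (\<lambda>n. scale c (v n))"

text \<open>
  HOL cannot quantify existentially over the type of the target algebra, so the target is placed
  on one fixed vector space, the sequences in the given algebra. This loses no generality: by
  \<open>differentially_specialI\<close> below, an algebra that embeds into a derived algebra on any complex
  vector space of any type also embeds into one on its sequence space. The reason is that the
  subalgebra generated by the image under the product and the derivation has dimension at most
  \<open>\<aleph>\<^sub>0 * dim\<close>.
\<close>

definition differentially_special ::
    "complex \<Rightarrow> (complex \<Rightarrow> 'a::ab_group_add \<Rightarrow> 'a) \<Rightarrow> ('a \<Rightarrow> 'a \<Rightarrow> 'a) \<Rightarrow> bool" where
  "differentially_special \<delta> scale mul \<longleftrightarrow>
     differentially_special_in \<delta> (pointwise_scale scale) scale mul"

lemma vector_space_pointwise_scale: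
  assumes "vector_space scale"
  shows "vector_space (pointwise_scale scale)"
proof -
  interpret vector_space scale by fact
  show ?thesis
    by unfold_locales
      (auto simp: pointwise_scale_def fun_eq_iff scale_right_distrib scale_left_distrib)
qed

definition single_seq :: "nat \<Rightarrow> 'a::zero \<Rightarrow> nat \<Rightarrow> 'a" where
  "single_seq n b = (\<lambda>i. if i = n then b else 0)"

lemma independent_single_seq:
  assumes "vector_space scale" and ind: "\<not> module.dependent scale S"
  shows "\<not> module.dependent (pointwise_scale scale) (case_prod single_seq ` (UNIV \<times> S))"
proof -
  interpret A: vector_space scale by fact
  interpret V: vector_space "pointwise_scale scale"
    by (rule vector_space_pointwise_scale) fact
  interpret vector_space_pair "pointwise_scale scale" scale by unfold_locales
  let ?E = "case_prod single_seq ` (UNIV \<times> S)"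
  show ?thesis
  proof
    assume "V.dependent ?E"
    then obtain n b where b: "b \<in> S"
      and sp: "single_seq n b \<in> V.span (?E - {single_seq n b})"
      unfolding V.dependent_def by auto
    have lin: "Vector_Spaces.linear (pointwise_scale scale) scale (\<lambda>v. v n)"
      by unfold_locales (auto simp: pointwise_scale_def)
    have "(\<lambda>v. v n) ` V.span (?E - {single_seq n b}) = A.span ((\<lambda>v. v n) ` (?E - {single_seq n b}))"
      using linear_span_image[OF lin] by simp
    also have "\<dots> \<subseteq> A.span (insert 0 (S - {b}))"
    proof (intro A.span_mono subsetI)
      fix y assume "y \<in> (\<lambda>v. v n) ` (?E - {single_seq n b})"
      then obtain m c where "c \<in> S" "single_seq m c \<noteq> single_seq n b" "y = single_seq m c n"
        by auto
      then show "y \<in> insert 0 (S - {b})"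
        by (cases "m = n") (auto simp: single_seq_def)
    qed
    finally have "single_seq n b n \<in> A.span (insert 0 (S - {b}))"
      using sp by blast
    then have "b \<in> A.span (S - {b})" by (simp add: single_seq_def)
    with b ind show False unfolding A.dependent_def by blast
  qed
qed

definition closure_step :: "('b \<Rightarrow> 'b) \<Rightarrow> ('b \<Rightarrow> 'b \<Rightarrow> 'b) \<Rightarrow> 'b set \<Rightarrow> 'b set" where
  "closure_step \<phi> bmul Y = Y \<union> \<phi> ` Y \<union> case_prod bmul ` (Y \<times> Y)"

definition monomials :: "('b \<Rightarrow> 'b) \<Rightarrow> ('b \<Rightarrow> 'b \<Rightarrow> 'b) \<Rightarrow> 'b set \<Rightarrow> 'b set" where
  "monomials \<phi> bmul S = (\<Union>n. (closure_step \<phi> bmul ^^ n) S)"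

lemma monomials_base: "S \<subseteq> monomials \<phi> bmul S"
  unfolding monomials_def by (metis UNIV_I UN_upper funpow_0)

lemma closure_step_mono: "m \<le> n \<Longrightarrow> (closure_step \<phi> bmul ^^ m) S \<subseteq> (closure_step \<phi> bmul ^^ n) S"
  by (rule lift_Suc_mono_le[of "\<lambda>n. (closure_step \<phi> bmul ^^ n) S"]) (auto simp: closure_step_def)

lemma monomials_derivation: "x \<in> monomials \<phi> bmul S \<Longrightarrow> \<phi> x \<in> monomials \<phi> bmul S"
proof -
  assume "x \<in> monomials \<phi> bmul S"
  then obtain n where "x \<in> (closure_step \<phi> bmul ^^ n) S" by (auto simp: monomials_def)
  then have "\<phi> x \<in> (closure_step \<phi> bmul ^^ Suc n) S" by (auto simp: closure_step_def)
  then show ?thesis unfolding monomials_def by blast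
qed

lemma monomials_mul:
  assumes "x \<in> monomials \<phi> bmul S" "y \<in> monomials \<phi> bmul S"
  shows "bmul x y \<in> monomials \<phi> bmul S"
proof -
  obtain m n where "x \<in> (closure_step \<phi> bmul ^^ m) S" "y \<in> (closure_step \<phi> bmul ^^ n) S"
    using assms by (auto simp: monomials_def)
  then have "x \<in> (closure_step \<phi> bmul ^^ max m n) S" "y \<in> (closure_step \<phi> bmul ^^ max m n) S"
    by (meson closure_step_mono max.cobounded1 max.cobounded2 subsetD)+
  then have "bmul x y \<in> (closure_step \<phi> bmul ^^ Suc (max m n)) S" by (force simp: closure_step_def)
  then show ?thesis unfolding monomials_def by blast
qed

lemma card_of_monomials:
  includes cardinal_syntax
  fixes X :: "'c set"
  assumes inf: "\<not> finite X" and S: "|S| \<le>o |X|"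
  shows "|monomials \<phi> bmul S| \<le>o |X|"
proof -
  have F: "Field |X| = X" "Card_order |X|" by (rule Field_card_of card_of_Card_order)+
  have step: "|closure_step \<phi> bmul Y| \<le>o |X|" if Y: "|Y| \<le>o |X|" for Y
  proof -
    have "|Y \<times> Y| \<le>o |X|"
      using card_of_Times_ordLeq_infinite_Field[of "|X|" Y Y] inf Y F by simp
    then have "|case_prod bmul ` (Y \<times> Y)| \<le>o |X|" "|\<phi> ` Y| \<le>o |X|"
      using card_of_image ordLeq_transitive Y by blast+
    then show ?thesis
      unfolding closure_step_def using Y F inf
      by (intro card_of_Un_ordLeq_infinite_Field) auto
  qed
  have "|(closure_step \<phi> bmul ^^ n) S| \<le>o |X|" for n
    by (induction n) (auto simp: S step)
  moreover have "|UNIV :: nat set| \<le>o |X|"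
    using inf infinite_iff_card_of_nat by blast
  ultimately show ?thesis
    unfolding monomials_def by (intro card_of_UNION_ordLeq_infinite inf) auto
qed

lemma monomials_empty: "monomials \<phi> bmul {} = {}"
proof -
  have "(closure_step \<phi> bmul ^^ n) {} = {}" for n
    by (induction n) (auto simp: closure_step_def)
  then show ?thesis by (simp add: monomials_def)
qed

text \<open>The choice of the sequence space in the definition is immaterial.\<close>

theorem differentially_specialI:
  includes cardinal_syntax
  fixes scale :: "complex \<Rightarrow> 'a::ab_group_add \<Rightarrow> 'a"
    and bscale :: "complex \<Rightarrow> 'b::ab_group_add \<Rightarrow> 'b"
  assumes "vector_space scale" and special: "differentially_special_in \<delta> bscale scale mul"
  shows "differentially_special \<delta> scale mul"
proof -
  obtain bmul \<phi> f where "differential_anticomm_antiassoc_algebra \<delta> bscale bmul \<phi>"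
    and hom: "algebra_hom scale mul bscale (derived_mul bmul \<phi>) f" and "inj f"
    using special unfolding differentially_special_in_def by blast
  interpret B: differential_anticomm_antiassoc_algebra \<delta> bscale bmul \<phi> by fact
  interpret A: vector_space scale by fact
  let ?V = "pointwise_scale scale"
  interpret V: vector_space ?V by (rule vector_space_pointwise_scale) fact
  interpret VB: vector_space_pair ?V bscale by unfold_locales
  interpret BV: vector_space_pair bscale ?V by unfold_locales
  interpret AB: vector_space_pair scale bscale by unfold_locales
  interpret f: Vector_Spaces.linear scale bscale f using hom by (simp add: algebra_hom_def)
  interpret phi: Vector_Spaces.linear bscale bscale \<phi> by (rule B.linear_derivation)
  interpret ml: Vector_Spaces.linear bscale bscale "\<lambda>x. bmul x y" for y by (rule B.linear_mul_left)
  interpret mr: Vector_Spaces.linear bscale bscale "bmul x" for x by (rule B.linear_mul_right)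
  have f_mul: "f (mul x y) = bmul (f x) (\<phi> (f y))" for x y
    using hom by (simp add: algebra_hom_def derived_mul_def)
  obtain S where S: "A.independent S" "UNIV \<subseteq> A.span S"
    using A.maximal_independent_subset[of UNIV] by metis
  define M where "M = monomials \<phi> bmul (f ` S)"
  have "|M| \<le>o |(UNIV :: nat set) \<times> S|"
  proof (cases "S = {}")
    case True
    then show ?thesis by (simp add: M_def monomials_empty card_of_empty)
  next
    case False
    then have "\<not> finite ((UNIV :: nat set) \<times> S)"
      by (simp add: finite_cartesian_product_iff)
    moreover have "|f ` S| \<le>o |(UNIV :: nat set) \<times> S|"
by (rule ordLeq_transitive[OF card_of_image card_of_Times2]) simp
    ultimately show ?thesis unfolding M_def by (rule card_of_monomials)
  qed
  then obtain k where k: "inj_on k M" "k ` M \<subseteq> (UNIV :: nat set) \<times> S"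
    unfolding card_of_ordLeq[symmetric] by blast
  obtain C where C: "C \<subseteq> M" "B.independent C" "M \<subseteq> B.span C"
    using B.maximal_independent_subset[of M] by metis
  have span_CM: "B.span C = B.span M"
    using C by (metis B.span_eq B.span_superset order_trans)
  define K where "K = (\<lambda>c. case_prod single_seq (k c))"
  have "0 \<notin> S" using S(1) A.dependent_zero by blast
  then have inj_single: "inj_on (case_prod single_seq) (UNIV \<times> S)"
    by (auto simp: inj_on_def single_seq_def fun_eq_iff)
  have inj_K: "inj_on K C"
    using comp_inj_on[OF k(1) inj_on_subset[OF inj_single k(2)]] C(1)
    by (auto simp: comp_def K_def intro: inj_on_subset)
  have "K ` C \<subseteq> case_prod single_seq ` (UNIV \<times> S)"
    using k(2) C(1) by (auto simp: K_def)
  then have KC: "V.independent (K ` C)"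
    using independent_single_seq[OF assms(1) S(1)] V.independent_mono by blast
  define g where "g = BV.construct C K"
  define h where "h = VB.construct (K ` C) (the_inv_into C K)"
  have lin_g: "Vector_Spaces.linear bscale ?V g"
    unfolding g_def by (rule BV.linear_construct) fact
  have lin_h: "Vector_Spaces.linear ?V bscale h"
    unfolding h_def by (rule VB.linear_construct) fact
  interpret g: Vector_Spaces.linear bscale ?V g by fact
  interpret h: Vector_Spaces.linear ?V bscale h by fact
  have hg_C: "h (g c) = c" if "c \<in> C" for c
    unfolding g_def h_def BV.construct_basis[OF C(2) that]
    using VB.construct_basis[OF KC, of "K c"] the_inv_into_f_f[OF inj_K that] that by simp
  have hg: "h (g x) = x" if "x \<in> B.span M" for x
    using that unfolding span_CM[symmetric]
  proof (induction rule: B.span_induct_alt)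
    case (step c x y)
    then show ?case by (simp only: g.add g.scale h.add h.scale hg_C)
  qed (simp only: g.zero h.zero)
  have h_M: "h v \<in> B.span M" for v
  proof -
    have "the_inv_into C K ` K ` C = C"
      using inj_K by (force simp: the_inv_into_f_f)
    then show ?thesis
      using VB.construct_in_span[OF KC, of "the_inv_into C K" v] by (simp add: h_def span_CM)
  qed
  have M_phi: "\<phi> x \<in> B.span M" if "x \<in> B.span M" for x
    using that
  proof (induction rule: B.span_induct_alt)
    case (step c x y)
    then show ?case
      using monomials_derivation[of x \<phi> bmul "f ` S"]
      by (simp add: phi.add phi.scale M_def B.span_add B.span_scale B.span_base)
  qed (simp add: B.span_zero phi.zero ml.zero mr.zero)
  have M_mul1: "bmul x y \<in> B.span M" if "x \<in> M" "y \<in> B.span M" for x y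
    using that(2)
  proof (induction rule: B.span_induct_alt)
    case (step c y z)
    then show ?case
      using monomials_mul[of x \<phi> bmul "f ` S" y] that(1)
      by (simp add: mr.add mr.scale M_def B.span_add B.span_scale B.span_base)
  qed (simp add: B.span_zero phi.zero ml.zero mr.zero)
  have M_mul: "bmul x y \<in> B.span M" if "x \<in> B.span M" "y \<in> B.span M" for x y
    using that(1)
  proof (induction rule: B.span_induct_alt)
    case (step c x z)
    then show ?case
      using M_mul1[OF _ that(2)]
      by (simp add: ml.add ml.scale B.span_add B.span_scale)
  qed (simp add: B.span_zero phi.zero ml.zero mr.zero)
  have f_M: "f x \<in> B.span M" for x
  proof -
    have "f x \<in> f ` A.span S" using S(2) by blast
    also have "\<dots> = B.span (f ` S)" using AB.linear_span_image[OF f.linear_axioms] by simp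
    also have "\<dots> \<subseteq> B.span M" unfolding M_def by (intro B.span_mono monomials_base)
    finally show ?thesis .
  qed
  define vmul where "vmul = (\<lambda>x y. g (bmul (h x) (h y)))"
  have V_mul_lin: "Vector_Spaces.linear ?V ?V (\<lambda>x. vmul x y)"
    "Vector_Spaces.linear ?V ?V (vmul x)" for x y
    by (unfold_locales; simp add: vmul_def g.add g.scale h.add h.scale ml.add ml.scale mr.add mr.scale)+
  have V_alg: "differential_anticomm_antiassoc_algebra \<delta> ?V vmul (\<lambda>x. g (\<phi> (h x)))"
  proof (unfold_locales, goal_cases)
    case (5 x y)
    show ?case unfolding vmul_def by (subst B.anticommutative) (rule g.neg)
  next
    case (6 x y z)
    show ?case by (simp add: vmul_def hg M_mul h_M B.antiassociative g.neg)
  next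
    case (9 x y)
    show ?case by (simp add: vmul_def hg M_mul M_phi h_M B.derivation g.add g.scale)
  qed (simp_all add: vmul_def g.add g.scale h.add h.scale ml.add ml.scale mr.add mr.scale phi.add phi.scale)
  have V_hom: "algebra_hom scale mul ?V (derived_mul vmul (\<lambda>x. g (\<phi> (h x)))) (\<lambda>x. g (f x))"
    unfolding algebra_hom_def
  proof
    show "Vector_Spaces.linear scale ?V (\<lambda>x. g (f x))"
      by unfold_locales (simp_all add: f.add f.scale g.add g.scale)
  qed (simp add: derived_mul_def vmul_def f_mul hg f_M M_phi)
  have "inj (\<lambda>x. g (f x))"
    using \<open>inj f\<close> hg[OF f_M] by (metis (mono_tags, lifting) injD injI)
  with V_alg V_hom show ?thesis
    unfolding differentially_special_def differentially_special_in_def by blast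
qed

end

(* Split A = C + A^2 and let pi be the projection onto C along A^2.
   The target is (C x0 + C x1) + (A w0 + A w1), where phi sends x0 to x1, w1 to w0 and kills x1, w0,
   the only nonzero products are
     (a x0)(b x1) = - (b x1)(a x0) = (a o b) w0  and  (a x0)(b x0) = delta (a o b - b o a) w1,
   and the summand A w0 + A w1 annihilates everything. Then a |-> (pi a) x0 + a w0 is the embedding:
   pi vanishes on A^2, and a o b = pi a o pi b. *)
theory Submission
  imports Defs
begin

text \<open>The coordinates 0, 1, 2, 3 of a sequence are those of \<open>x0\<close>, \<open>x1\<close>, \<open>w0\<close>, \<open>w1\<close>; the coordinates
  0 and 1 range over all of \<open>A\<close> instead of \<open>C\<close>, which does no harm.\<close>

definition envelope_mul ::
    "complex \<Rightarrow> (complex \<Rightarrow> 'a::ab_group_add \<Rightarrow> 'a) \<Rightarrow> ('a \<Rightarrow> 'a \<Rightarrow> 'a) \<Rightarrow>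
     (nat \<Rightarrow> 'a) \<Rightarrow> (nat \<Rightarrow> 'a) \<Rightarrow> nat \<Rightarrow> 'a" where
  "envelope_mul \<delta> scale mul u v = (\<lambda>n.
     if n = 2 then mul (u 0) (v 1) - mul (v 0) (u 1)
     else if n = 3 then scale \<delta> (mul (u 0) (v 0) - mul (v 0) (u 0))
     else 0)"

definition envelope_deriv :: "(nat \<Rightarrow> 'a::zero) \<Rightarrow> nat \<Rightarrow> 'a" where
  "envelope_deriv u = (\<lambda>n. if n = 1 then u 0 else if n = 2 then u 3 else 0)"

text \<open>Products live in coordinates 2 and 3 but are computed from coordinates 0 and 1, so all
  triple products vanish. In the derivation law only coordinate 2 is nontrivial: both sides are
  \<open>\<delta>\<close> times the commutator of \<open>x 0\<close> and \<open>y 0\<close>.\<close>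

lemma (in nonassoc_algebra) envelope_algebra:
  "differential_anticomm_antiassoc_algebra \<delta> (pointwise_scale scale)
     (envelope_mul \<delta> scale mul) envelope_deriv"
proof -
  interpret V: vector_space "pointwise_scale scale"
    by (rule vector_space_pointwise_scale) unfold_locales
  interpret ml: Vector_Spaces.linear scale scale "\<lambda>x. mul x y" for y by (rule linear_mul_left)
  interpret mr: Vector_Spaces.linear scale scale "mul x" for x by (rule linear_mul_right)
  note bilinear = ml.add mr.add ml.scale mr.scale ml.zero mr.zero
  show ?thesis
    by unfold_locales
      (simp_all add: fun_eq_iff pointwise_scale_def envelope_mul_def envelope_deriv_def bilinear
        algebra_simps scale_left_commute)
qed

text \<open>\<open>a\<close> and \<open>\<pi> a\<close> differ by an element of the square, which
  annihilates everything.\<close>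

lemma (in nonassoc_algebra) projection_along_square:
  assumes "algebra_square scale mul \<subseteq> algebra_annihilator mul"
  obtains \<pi> where "Vector_Spaces.linear scale scale \<pi>"
    and "\<And>a b. \<pi> (mul a b) = 0" and "\<And>a b. mul (\<pi> a) (\<pi> b) = mul a b"
proof -
  interpret vector_space_pair scale scale by unfold_locales
  interpret ml: Vector_Spaces.linear scale scale "\<lambda>x. mul x y" for y by (rule linear_mul_left)
  interpret mr: Vector_Spaces.linear scale scale "mul x" for x by (rule linear_mul_right)
  let ?S = "algebra_square scale mul"
  have "subspace ?S" by (simp add: algebra_square_def subspace_span)
  \<comment> \<open>A left inverse of \<open>id\<close> on \<open>?S\<close> with range in
    \<open>?S\<close> is a projection onto \<open>?S\<close>; its complementary projection serves as
    \<open>\<pi>\<close>.\<close>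
  then obtain g where g: "Vector_Spaces.linear scale scale g" "range g \<subseteq> ?S" "\<And>x. x \<in> ?S \<Longrightarrow> g x = x"
    using linear_exists_left_inverse_on[OF linear_id, of ?S] by auto
  interpret g: Vector_Spaces.linear scale scale g by fact
  have ann: "mul (g a) b = 0" "mul b (g a) = 0" for a b
    using g(2) assms by (auto simp: algebra_annihilator_def)
  show ?thesis
  proof
    show "Vector_Spaces.linear scale scale (\<lambda>a. a - g a)"
      by unfold_locales (simp_all add: g.add g.scale algebra_simps)
    show "mul a b - g (mul a b) = 0" for a b
    proof -
      have "mul a b \<in> ?S" unfolding algebra_square_def by (rule span_base) blast
      then show ?thesis by (simp add: g(3))
    qed
    show "mul (a - g a) (b - g b) = mul a b" for a b
      by (simp add: ml.diff mr.diff ann)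
  qed
qed

theorem theorem2p13:
  fixes \<delta> :: complex
    and scale :: "complex \<Rightarrow> 'a::ab_group_add \<Rightarrow> 'a"
    and mul :: "'a \<Rightarrow> 'a \<Rightarrow> 'a"
  assumes "\<delta> \<noteq> 0"
    and "mock_novikov_algebra \<delta> scale mul"
    and "algebra_square scale mul \<subseteq> algebra_annihilator mul"
  shows "differentially_special \<delta> scale mul"
proof -
  interpret mock_novikov_algebra \<delta> scale mul by fact
  interpret V: vector_space "pointwise_scale scale"
    by (rule vector_space_pointwise_scale) unfold_locales
  interpret ml: Vector_Spaces.linear scale scale "\<lambda>x. mul x y" for y by (rule linear_mul_left)
  interpret mr: Vector_Spaces.linear scale scale "mul x" for x by (rule linear_mul_right)
  obtain \<pi> where lin: "Vector_Spaces.linear scale scale \<pi>"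
    and \<pi>: "\<And>a b. \<pi> (mul a b) = 0" "\<And>a b. mul (\<pi> a) (\<pi> b) = mul a b"
    using projection_along_square[OF assms(3)] by blast
  interpret p: Vector_Spaces.linear scale scale \<pi> by fact
  define f where "f a = (\<lambda>n::nat. if n = 0 then \<pi> a else if n = 2 then a else 0)" for a
  have "Vector_Spaces.linear scale (pointwise_scale scale) f"
    by unfold_locales (simp_all add: f_def fun_eq_iff pointwise_scale_def p.add p.scale)
  \<comment> \<open>\<open>envelope_deriv (f b)\<close> is \<open>\<pi> b\<close> in coordinate 1
    and 0 elsewhere, so only coordinate 2 of the product survives.\<close>
  moreover have "f (mul a b) =
      derived_mul (envelope_mul \<delta> scale mul) envelope_deriv (f a) (f b)" for a b
    by (simp add: fun_eq_iff f_def derived_mul_def envelope_mul_def envelope_deriv_def \<pi>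
        ml.zero mr.zero)
  ultimately have "algebra_hom scale mul (pointwise_scale scale)
      (derived_mul (envelope_mul \<delta> scale mul) envelope_deriv) f"
    by (simp add: algebra_hom_def)
  moreover have "inj f"
  proof (rule injI)
    fix a b assume "f a = f b"
    \<comment> \<open>Coordinate 2 keeps all of \<open>a\<close>, including the part killed by
      \<open>\<pi>\<close>.\<close>
    then have "f a 2 = f b 2" by simp
    then show "a = b" by (simp add: f_def)
  qed
  ultimately show ?thesis
    using envelope_algebra unfolding differentially_special_def differentially_special_in_def by blast
qed

end
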